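(* Let $L<M<H$ be reals, $n\ge 2$, $1\le k\le n$, and consider the $k$-item procurement auction with $n$ agents over the three-values domain $\Theta=\{L,M,H\}^n$. The $\lambda_M$-linear mechanism, which selects the $k$ agents with the smallest reported types (breaking ties in favor of agents with smaller index), pays $M$ to each selected agent and pays $0$ to each non-selected agent, is bribeproof on $\Theta$.
   Context: In the $k$-item procurement auction there are agents $N=\{1,\dots,n\}$, and a feasible allocation is a vector $a\in\{0,1\}^n$ with exactly $k$ ones (the selected agents). Agent $i$ has private type $\theta_i\in\Theta_i$ and her cost for $a$ is $a_i\theta_i$. $\Theta=\Theta_1\times\cdots\times\Theta_n$. A mechanism is a pair $(A,p)$ with $A$ mapping each $\theta\in\Theta$ to a feasible allocation and $p:\Theta\to\mathbb{R}^n$ giving payments to the agents. With $\lambda_M:=\frac{H-M}{H-L}$, so that $M=\lambda_M L+(1-\lambda_M)H$, the mechanism in the statement has payments $p_i(\theta)=M\cdot A_i(\theta)$; this is a $\lambda$-linear mechanism (payments $A_i(\theta)(\lambda L+(1-\lambda)H)+f_i$) with $\lambda=\lambda_M$, $f_i=0$. $(A,p)$ is bribeproof if for all $\theta\in\Theta$, all $i,j\in N$ and all $\hat\theta_i\in\Theta_i$, with $\hat\theta$ denoting $\theta$ with its $i$-th entry replaced by $\hat\theta_i$: if $i\neq j$, $p_i(\theta)-A_i(\theta)\theta_i+p_j(\theta)-A_j(\theta)\theta_j\ge p_i(\hat\theta)-A_i(\hat\theta)\theta_i+p_j(\hat\theta)-A_j(\hat\theta)\theta_j$; and, for $i=j$,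 $p_i(\theta)-A_i(\theta)\theta_i\ge p_i(\hat\theta)-A_i(\hat\theta)\theta_i$. *)

theory Defs
  imports Complex_Main "HOL-Library.FuncSet"
begin

text \<open>
  Vectors indexed by the agents \<open>1, \<dots>, n\<close> are extensional functions on \<open>{1..n}\<close>.
\<close>

type_synonym vec = "nat \<Rightarrow> real"

abbreviation agents :: "nat \<Rightarrow> nat set" where
  "agents n \<equiv> {1..n}"

definition type_profiles :: "nat \<Rightarrow> (nat \<Rightarrow> real set) \<Rightarrow> vec set" where
  "type_profiles n T = (\<Pi>\<^sub>E i\<in>agents n. T i)"

definition feasible_allocations :: "nat \<Rightarrow> nat \<Rightarrow> vec set" where
  "feasible_allocations n k =
     {a \<in> agents n \<rightarrow>\<^sub>E {0, 1}. card {i \<in> agents n. a i = 1} = k}"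

definition procurement_mechanism ::
  "nat \<Rightarrow> nat \<Rightarrow> (nat \<Rightarrow> real set) \<Rightarrow> (vec \<Rightarrow> vec) \<Rightarrow> (vec \<Rightarrow> vec) \<Rightarrow> bool" where
  "procurement_mechanism n k T A p \<longleftrightarrow>
     (\<forall>\<theta>\<in>type_profiles n T.
        A \<theta> \<in> feasible_allocations n k \<and> p \<theta> \<in> agents n \<rightarrow>\<^sub>E UNIV)"

text \<open>
  In \<open>utility A p c \<theta> i\<close> the number \<open>c\<close> is the true type of agent \<open>i\<close>, whereas \<open>\<theta>\<close> is the
  profile of reported types.
\<close>

definition utility :: "(vec \<Rightarrow> vec) \<Rightarrow> (vec \<Rightarrow> vec) \<Rightarrow> real \<Rightarrow> vec \<Rightarrow> nat \<Rightarrow> real" where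
  "utility A p c \<theta> i = p \<theta> i - A \<theta> i * c"

definition bribeproof ::
  "nat \<Rightarrow> (nat \<Rightarrow> real set) \<Rightarrow> (vec \<Rightarrow> vec) \<Rightarrow> (vec \<Rightarrow> vec) \<Rightarrow> bool" where
  "bribeproof n T A p \<longleftrightarrow>
     (\<forall>\<theta>\<in>type_profiles n T. \<forall>i\<in>agents n. \<forall>j\<in>agents n. \<forall>t\<in>T i.
        (i \<noteq> j \<longrightarrow>
           utility A p (\<theta> i) \<theta> i + utility A p (\<theta> j) \<theta> j
             \<ge> utility A p (\<theta> i) (\<theta>(i := t)) i + utility A p (\<theta> j) (\<theta>(i := t)) j) \<and>
        (i = j \<longrightarrow>
           utility A p (\<theta> i) \<theta> i \<ge> utility A p (\<theta> i) (\<theta>(i := t)) i))"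

text \<open>
  Ordering the agents by reported type, and agents of equal type by index, is a strict
  linear order; the selected agents are the first \<open>k\<close> in this order, i.e. those with
  fewer than \<open>k\<close> predecessors.
\<close>

definition precedes :: "vec \<Rightarrow> nat \<Rightarrow> nat \<Rightarrow> bool" where
  "precedes \<theta> j i \<longleftrightarrow> \<theta> j < \<theta> i \<or> (\<theta> j = \<theta> i \<and> j < i)"

definition smallest_types_allocation :: "nat \<Rightarrow> nat \<Rightarrow> vec \<Rightarrow> vec" where
  "smallest_types_allocation n k \<theta> =
     (\<lambda>i\<in>agents n. if card {j \<in> agents n. precedes \<theta> j i} < k then 1 else 0)"

definition linear_payment ::
  "nat \<Rightarrow> real \<Rightarrow> real \<Rightarrow> real \<Rightarrow> vec \<Rightarrow> (vec \<Rightarrow> vec) \<Rightarrow> vec \<Rightarrow> vec" where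
  "linear_payment n L H l f A \<theta> =
     (\<lambda>i\<in>agents n. A \<theta> i * (l * L + (1 - l) * H) + f i)"

definition lambda_of :: "real \<Rightarrow> real \<Rightarrow> real \<Rightarrow> real" where
  "lambda_of L M H = (H - M) / (H - L)"

end

theory Submission
  imports Defs
begin

text \<open>
  A change of agent \<open>i\<close>'s report changes the selection either not at all, or by exchanging
  \<open>i\<close> with one other agent. A selected agent with type \<open>c\<close> gains \<open>M - c\<close>, and the selected agent
  of the exchanged pair has the smaller type. Hence an exchange within the pair of colluders
  never increases the sum of their gains. In any other exchange only \<open>i\<close>'s own gain counts.
  If \<open>i\<close> becomes selected, her report has decreased, so her type is at least \<open>M\<close>;
  if she stops being selected, her report has increased, so her type is at most \<open>M\<close>.
\<close>

text \<open>For an agent this is the position in the order \<open>precedes \<theta>\<close>, counted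
  from 0, which is why selection means \<open>rank < k\<close>.\<close>

definition rank :: "nat \<Rightarrow> vec \<Rightarrow> nat \<Rightarrow> nat" where
  "rank n \<theta> i = card {j \<in> agents n. precedes \<theta> j i}"

definition selected :: "nat \<Rightarrow> nat \<Rightarrow> vec \<Rightarrow> nat set" where
  "selected n k \<theta> = {i \<in> agents n. rank n \<theta> i < k}"

lemma finite_selected [simp]: "finite (selected n k \<theta>)"
  by (simp add: selected_def)

lemma smallest_types_allocation_eq:
  "i \<in> agents n \<Longrightarrow> smallest_types_allocation n k \<theta> i = of_bool (i \<in> selected n k \<theta>)"
  by (simp add: smallest_types_allocation_def selected_def rank_def)

text \<open>By transitivity the predecessors of \<open>i\<close> also precede \<open>j\<close>; the
  inclusion is strict because \<open>i\<close> precedes \<open>j\<close> but not itself.\<close>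

lemma rank_less:
  assumes "precedes \<theta> i j" and "i \<in> agents n"
  shows "rank n \<theta> i < rank n \<theta> j"
  unfolding rank_def
proof (rule psubset_card_mono)
  show "{m \<in> agents n. precedes \<theta> m i} \<subset> {m \<in> agents n. precedes \<theta> m j}"
  proof
    show "{m \<in> agents n. precedes \<theta> m i} \<subseteq> {m \<in> agents n. precedes \<theta> m j}"
      using assms(1) by (auto simp: precedes_def)
    have "i \<in> {m \<in> agents n. precedes \<theta> m j}" "i \<notin> {m \<in> agents n. precedes \<theta> m i}"
      using assms by (auto simp: precedes_def)
    then show "{m \<in> agents n. precedes \<theta> m i} \<noteq> {m \<in> agents n. precedes \<theta> m j}"
      by blast
  qed
qed simp

text \<open>Injectivity comes from totality of the order, which the tie-breaking by index ensures.
  Since no agent precedes itself, ranks stay below \<open>n\<close>, and counting gives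
  surjectivity.\<close>

lemma bij_betw_rank: "bij_betw (rank n \<theta>) (agents n) {..<n}"
proof -
  have inj: "inj_on (rank n \<theta>) (agents n)"
  proof (rule inj_onI, rule ccontr)
    fix i j
    assume ij: "i \<in> agents n" "j \<in> agents n" and eq: "rank n \<theta> i = rank n \<theta> j" and "i \<noteq> j"
    then consider "precedes \<theta> i j" | "precedes \<theta> j i"
      unfolding precedes_def by linarith
    then show False
      using rank_less[of \<theta> i j n] rank_less[of \<theta> j i n] ij eq by cases simp_all
  qed
  have "rank n \<theta> i < n" if "i \<in> agents n" for i
  proof -
    have "{j \<in> agents n. precedes \<theta> j i} \<subset> agents n"
      using that unfolding precedes_def by blast
    then show ?thesis
      unfolding rank_def using psubset_card_mono[of "agents n"] by simp
  qed
  then have "rank n \<theta> ` agents n = {..<n}"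
    using inj by (intro card_subset_eq) (auto simp: card_image)
  with inj show ?thesis
    by (simp add: bij_betw_def)
qed

text \<open>The selected agents are the preimage of \<open>{..<k}\<close> under the bijection
  \<open>rank\<close>; \<open>k \<le> n\<close> makes every rank below \<open>k\<close>
  occur.\<close>

lemma card_selected:
  assumes "k \<le> n"
  shows "card (selected n k \<theta>) = k"
proof -
  have "rank n \<theta> ` selected n k \<theta> = {..<k}"
  proof
    show "{..<k} \<subseteq> rank n \<theta> ` selected n k \<theta>"
    proof
      fix r
      assume "r \<in> {..<k}"
      with assms have "r < k" "r \<in> rank n \<theta> ` agents n"
        using bij_betw_rank[of n \<theta>] by (auto simp: bij_betw_def)
      then show "r \<in> rank n \<theta> ` selected n k \<theta>"
        by (auto simp: selected_def)
    qed
  qed (auto simp: selected_def)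
  moreover have "inj_on (rank n \<theta>) (selected n k \<theta>)"
    using bij_betw_rank by (rule inj_on_subset[OF bij_betw_imp_inj_on]) (auto simp: selected_def)
  ultimately show ?thesis
    by (metis card_image card_lessThan)
qed

lemma selected_le_not_selected:
  assumes "i \<in> selected n k \<theta>" "j \<in> agents n" "j \<notin> selected n k \<theta>"
  shows "\<theta> i \<le> \<theta> j"
proof (rule ccontr)
  assume "\<not> \<theta> i \<le> \<theta> j"
  then have "rank n \<theta> j < rank n \<theta> i"
    using assms by (intro rank_less) (auto simp: precedes_def)
  with assms show False
    by (simp add: selected_def)
qed

text \<open>A higher report of \<open>i\<close> can only add agents to those preceding
  \<open>i\<close>.\<close>

lemma selected_raise_self:
  assumes "\<theta> i \<le> t" and "i \<in> selected n k (\<theta>(i := t))"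
  shows "i \<in> selected n k \<theta>"
proof -
  have "rank n \<theta> i \<le> rank n (\<theta>(i := t)) i"
    unfolding rank_def using assms(1) by (intro card_mono) (auto simp: precedes_def)
  with assms(2) show ?thesis
    by (simp add: selected_def)
qed

text \<open>Among the predecessors of \<open>j\<close>, only the membership of \<open>i\<close> can
  change, and a higher report can only remove it.\<close>

lemma selected_raise_other:
  assumes "\<theta> i \<le> t" and "j \<noteq> i" and "j \<in> selected n k \<theta>"
  shows "j \<in> selected n k (\<theta>(i := t))"
proof -
  have "rank n (\<theta>(i := t)) j \<le> rank n \<theta> j"
    unfolding rank_def using assms(1,2)
    by (intro card_mono) (auto simp: precedes_def split: if_splits)
  with assms(3) show ?thesis
    by (simp add: selected_def)
qed

text \<open>The old selection is contained in the new one, and both have \<open>k\<close>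
  elements.\<close>

lemma selected_raise_nonbossy:
  assumes "k \<le> n" and "\<theta> i \<le> t"
    and "i \<in> selected n k (\<theta>(i := t)) \<longleftrightarrow> i \<in> selected n k \<theta>"
  shows "selected n k (\<theta>(i := t)) = selected n k \<theta>"
proof (rule sym, rule card_subset_eq)
  show "selected n k \<theta> \<subseteq> selected n k (\<theta>(i := t))"
  proof
    fix j
    assume "j \<in> selected n k \<theta>"
    then show "j \<in> selected n k (\<theta>(i := t))"
      using assms(3) selected_raise_other[of \<theta> i t, OF assms(2)] by (cases "j = i") simp_all
  qed
qed (simp_all add: assms(1) card_selected)

text \<open>The inclusions in \<open>leave\<close> and \<open>enter\<close> say that a deviation of
  \<open>i\<close> never moves another agent in the same direction as \<open>i\<close>.\<close>

lemma selected_cases: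
  assumes "k \<le> n"
  obtains
    (same) "selected n k (\<theta>(i := t)) = selected n k \<theta>"
  | (leave) "\<theta> i < t" "i \<in> selected n k \<theta>" "i \<notin> selected n k (\<theta>(i := t))"
      "selected n k \<theta> - {i} \<subseteq> selected n k (\<theta>(i := t))"
  | (enter) "t < \<theta> i" "i \<notin> selected n k \<theta>" "i \<in> selected n k (\<theta>(i := t))"
      "selected n k (\<theta>(i := t)) - {i} \<subseteq> selected n k \<theta>"
proof (cases "\<theta> i" t rule: linorder_cases)
  case less
  then have "\<theta> i \<le> t"
    by simp
  have "selected n k \<theta> - {i} \<subseteq> selected n k (\<theta>(i := t))"
    using selected_raise_other[of \<theta> i t] \<open>\<theta> i \<le> t\<close> by auto
  then show thesis
    using selected_raise_nonbossy[of k n \<theta> i t, OF assms \<open>\<theta> i \<le> t\<close>]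
      selected_raise_self[of \<theta> i t n k, OF \<open>\<theta> i \<le> t\<close>] less same leave
    by argo
next
  case equal
  then have "\<theta>(i := t) = \<theta>"
    by auto
  with same show thesis
    by simp
next
  case greater
  \<comment> \<open>A lowered report is treated as a raise read backwards: \<open>\<theta>\<close>
    arises from \<open>\<eta>\<close> by raising the report of \<open>i\<close> to
    \<open>\<theta> i\<close>.\<close>
  define \<eta> where "\<eta> = \<theta>(i := t)"
  have \<theta>: "\<eta>(i := \<theta> i) = \<theta>" and "\<eta> i \<le> \<theta> i"
    using greater by (auto simp: \<eta>_def)
  have "selected n k \<eta> - {i} \<subseteq> selected n k \<theta>"
    using selected_raise_other[of \<eta> i "\<theta> i"] \<open>\<eta> i \<le> \<theta> i\<close> unfolding \<theta> by auto
  then show thesis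
    using selected_raise_nonbossy[of k n \<eta> i "\<theta> i", OF assms \<open>\<eta> i \<le> \<theta> i\<close>]
      selected_raise_self[of \<eta> i "\<theta> i" n k, OF \<open>\<eta> i \<le> \<theta> i\<close>] greater same enter
    unfolding \<theta> \<eta>_def[symmetric] by argo
qed

lemma lambda_of_combination:
  "L < H \<Longrightarrow> lambda_of L M H * L + (1 - lambda_of L M H) * H = M"
  by (simp add: lambda_of_def divide_simps) (simp add: algebra_simps)

theorem theorem19:
  fixes L M H :: real and n k :: nat
    and T :: "nat \<Rightarrow> real set" and A p :: "vec \<Rightarrow> vec"
  assumes "L < M" and "M < H" and "n \<ge> 2" and "1 \<le> k" and "k \<le> n"
    and "T = (\<lambda>_. {L, M, H})"
    and "A = smallest_types_allocation n k"
    and "p = linear_payment n L H (lambda_of L M H) (\<lambda>_. 0) A"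
  shows "procurement_mechanism n k T A p \<and>
    (\<forall>\<theta>\<in>type_profiles n T. \<forall>i\<in>agents n. p \<theta> i = (if A \<theta> i = 1 then M else 0)) \<and>
    bribeproof n T A p"
proof -
  have pay: "p \<theta> i = (if i \<in> selected n k \<theta> then M else 0)"
    and alloc: "A \<theta> i = of_bool (i \<in> selected n k \<theta>)" if "i \<in> agents n" for \<theta> i
    using that assms lambda_of_combination[of L H M]
    by (auto simp: linear_payment_def smallest_types_allocation_eq)
  have "A \<theta> \<in> feasible_allocations n k" for \<theta>
  proof -
    have "{i \<in> agents n. A \<theta> i = 1} = selected n k \<theta>"
      using alloc by (auto simp: selected_def)
    then show ?thesis
      using assms card_selected[of k n \<theta>]
      by (auto simp: feasible_allocations_def smallest_types_allocation_def)
  qed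
  then have mechanism: "procurement_mechanism n k T A p"
    using assms by (auto simp: procurement_mechanism_def linear_payment_def)
  have util: "utility A p c \<theta> i = (if i \<in> selected n k \<theta> then M - c else 0)"
    if "i \<in> agents n" for c \<theta> i
    using pay alloc that by (simp add: utility_def)
  have "bribeproof n T A p"
    unfolding bribeproof_def
  proof (intro ballI)
    fix \<theta> i j t
    assume \<theta>: "\<theta> \<in> type_profiles n T" and ij: "i \<in> agents n" "j \<in> agents n" and "t \<in> T i"
    then have types: "\<theta> i \<in> {L, M, H}" "t \<in> {L, M, H}"
      using \<open>T = _\<close> PiE_mem[of \<theta> "agents n" T i] by (simp_all add: type_profiles_def)
    from \<open>k \<le> n\<close> show "(i \<noteq> j \<longrightarrow>
        utility A p (\<theta> i) \<theta> i + utility A p (\<theta> j) \<theta> j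
          \<ge> utility A p (\<theta> i) (\<theta>(i := t)) i + utility A p (\<theta> j) (\<theta>(i := t)) j) \<and>
      (i = j \<longrightarrow> utility A p (\<theta> i) \<theta> i \<ge> utility A p (\<theta> i) (\<theta>(i := t)) i)"
    proof (cases rule: selected_cases[where \<theta> = \<theta> and i = i and t = t])
      case same
      then show ?thesis
        using ij by (cases "i = j") (simp_all add: util)
    next
      case leave
      \<comment> \<open>Here the three-values domain enters: a type strictly below another one is
        \<open>L\<close> or \<open>M\<close>, hence at most the payment \<open>M\<close>.\<close>
      then have "\<theta> i \<le> M"
        using types \<open>L < M\<close> \<open>M < H\<close> by auto
      moreover have "j \<in> selected n k (\<theta>) \<Longrightarrow> i \<noteq> j \<Longrightarrow> j \<in> selected n k (\<theta>(i := t))"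
        using leave(4) by blast
      \<comment> \<open>If \<open>j\<close> was selected, it stays so and only the loss
        \<open>M - \<theta> i\<close> of \<open>i\<close> counts. Otherwise
        \<open>\<theta> i \<le> \<theta> j\<close>, so even if \<open>j\<close> takes the place of
        \<open>i\<close>, the new gain \<open>M - \<theta> j\<close> is no larger than the lost
        one.\<close>
      ultimately show ?thesis
        using ij leave(2,3) selected_le_not_selected[of i n k \<theta> j]
        by (cases "i = j") (simp_all add: util)
    next
      case enter
      then have "M \<le> \<theta> i"
        using types \<open>L < M\<close> \<open>M < H\<close> by auto
      moreover have "j \<in> selected n k (\<theta>(i := t)) \<Longrightarrow> i \<noteq> j \<Longrightarrow> j \<in> selected n k (\<theta>)"
        using enter(4) by blast
      \<comment> \<open>Dually, an unselected \<open>j\<close> stays out, and a selected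
        \<open>j\<close> has \<open>\<theta> j \<le> \<theta> i\<close>, so giving way to
        \<open>i\<close> does not pay for the pair.\<close>
      ultimately show ?thesis
        using ij enter(2,3) selected_le_not_selected[of j n k \<theta> i]
        by (cases "i = j") (simp_all add: util)
    qed
  qed
  with mechanism show ?thesis
    using pay alloc by simp
qed

end
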